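(* Let $X$ be an ANR, $G$ a (path-connected) group-like space, $m\ge2$, and $f_i\colon X\to G$ maps for $1\le i\le m$. Then $$\mathsf{D}(f_1,\dots,f_m)\le\mathsf{cat}(X)-\min\{\mathsf{dep}_{\mathcal G}(f_i)\mid 1\le i\le m\}+1,$$ where $\mathsf{dep}_{\mathcal G}(f_i)$ is the depth of $f_i$ in the nilpotent group $\mathcal G=[X,G]$ relative to the central series $\{\Gamma_j(\mathcal G)\}_j$ associated with a closed categorical cover of $X$ with $\mathsf{cat}(X)+1$ members.
   Context: A group-like space is a path-connected homotopy-associative $H$-space $G$ with multiplication $\mu$, identity $e$, and an inversion $\eta\colon G\to G$ with $\mu\circ(\mathrm{id}\times\eta)\circ\Delta\simeq c_e\simeq\mu\circ(\eta\times\mathrm{id})\circ\Delta$, where $c_e$ is the constant map at $e$ and $\Delta\colon G\to G\times G$ is the diagonal map. The set $\mathcal G=[X,G]$ of homotopy classes of maps is a group under $[\alpha]\cdot[\beta]=[\mu\circ(\alpha,\beta)]$. $\mathsf{D}(f_1,\dots,f_m)$ is the least $n\ge0$ such that $X$ is covered by $n+1$ open sets on each of which the restrictions of all the $f_i$ are mutually homotopic. $\mathsf{cat}(X)$ is the (normalized) Lusternik--Schnirelmann category: the least $n\ge0$ such that $X$ is covered by $n+1$ open sets whose inclusions into $X$ are null-homotopic; for an ANR closed covers may be used. Let $n=\mathsf{cat}(X)<\infty$ and let $\{A_i\}_{i=0}^n$ be a closed cover of $X$ with each inclusion $A_i\hookrightarrow X$ null-homotopic. For $1\le i\le n+1$ put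 $\mathcal A_{i-1}=\bigcup_{k=0}^{i-1}A_k$ and $\Gamma_i(\mathcal G)=\{[\alpha]\in[X,G]\mid\alpha|_{\mathcal A_{i-1}}\simeq *\}$. Then $\mathcal G=\Gamma_1(\mathcal G)\supset\dots\supset\Gamma_{n+1}(\mathcal G)=\{[c_e]\}$ is a central series. The depth $\mathsf{dep}_{\mathcal G}(f)$ of $f$ relative to this series is the integer $k$ such that $[f]\in\Gamma_k(\mathcal G)$ and $[f]\notin\Gamma_j(\mathcal G)$ for $j>k$. *)

theory Defs
  imports "HOL-Analysis.Analysis" "HOL-Algebra.Group"
begin

abbreviation homotopic_maps ::
    "'a topology \<Rightarrow> 'b topology \<Rightarrow> ('a \<Rightarrow> 'b) \<Rightarrow> ('a \<Rightarrow> 'b) \<Rightarrow> bool" where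
  "homotopic_maps \<equiv> homotopic_with (\<lambda>_. True)"

text \<open>
  Absolute neighbourhood retracts in the class of all metrizable spaces. (The library's ANR only
  considers closed copies inside the type \<open>'a \<times> real\<close>, which is too small for
  infinite-dimensional spaces.) HOL cannot quantify over all types inside a definition, so the
  ambient space \<open>Y\<close> ranges over the topologies on subsets of \<open>('a \<Rightarrow> real) \<times> real\<close>. This loses
  nothing. For a bounded metric on \<open>X\<close>, let \<open>K\<close> be the image of the Kuratowski embedding of \<open>X\<close>
  into the bounded functions \<open>B(X)\<close>. Then \<open>K \<times> {0}\<close> is closed in the metrizable space
  \<open>K \<times> {0} \<union> B(X) \<times> {t. 0 < t}\<close>, which lives on that type. If \<open>C\<close> is closed in a metrizable
  space \<open>Z\<close> of any type, a map from \<open>C\<close> to \<open>X\<close> extends to a map \<open>F\<close> from \<open>Z\<close> to \<open>B(X)\<close>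
  (Hausdorff's formula, coordinatewise), and pairing \<open>F\<close> with the distance to \<open>C\<close> gives a map
  into the space above. So a neighbourhood retraction there yields neighbourhood extensions, and
  hence neighbourhood retractions, for all metrizable \<open>Z\<close>.
\<close>

definition ANR_space :: "'a topology \<Rightarrow> bool" where
  "ANR_space X \<longleftrightarrow>
     metrizable_space X \<and>
     (\<forall>(Y :: (('a \<Rightarrow> real) \<times> real) topology) S.
        metrizable_space Y \<and> closedin Y S \<and> (subtopology Y S) homeomorphic_space X
        \<longrightarrow> (\<exists>U. openin Y U \<and> S retract_of_space (subtopology Y U)))"

text \<open>
  Unit, associativity and inverse laws hold up to free homotopy, matching the free homotopy
  classes that make up \<open>[X,G]\<close>. A path-connected topology may be empty in the library; here
  \<open>e \<in> topspace G\<close> excludes that.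
\<close>

definition H_space :: "'b topology \<Rightarrow> ('b \<times> 'b \<Rightarrow> 'b) \<Rightarrow> 'b \<Rightarrow> bool" where
  "H_space G \<mu> e \<longleftrightarrow>
     e \<in> topspace G \<and>
     continuous_map (prod_topology G G) G \<mu> \<and>
     homotopic_maps G G (\<lambda>x. \<mu> (e, x)) id \<and>
     homotopic_maps G G (\<lambda>x. \<mu> (x, e)) id"

definition group_like_space ::
    "'b topology \<Rightarrow> ('b \<times> 'b \<Rightarrow> 'b) \<Rightarrow> 'b \<Rightarrow> ('b \<Rightarrow> 'b) \<Rightarrow> bool" where
  "group_like_space G \<mu> e \<eta> \<longleftrightarrow>
     path_connected_space G \<and>
     H_space G \<mu> e \<and>
     homotopic_maps (prod_topology G (prod_topology G G)) G
       (\<lambda>(x, y, z). \<mu> (\<mu> (x, y), z)) (\<lambda>(x, y, z). \<mu> (x, \<mu> (y, z))) \<and>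
     continuous_map G G \<eta> \<and>
     homotopic_maps G G (\<lambda>x. \<mu> (x, \<eta> x)) (\<lambda>_. e) \<and>
     homotopic_maps G G (\<lambda>x. \<mu> (\<eta> x, x)) (\<lambda>_. e)"

definition homotopy_class :: "'a topology \<Rightarrow> 'b topology \<Rightarrow> ('a \<Rightarrow> 'b) \<Rightarrow> ('a \<Rightarrow> 'b) set" where
  "homotopy_class X G \<alpha> = {\<beta>. homotopic_maps X G \<alpha> \<beta>}"

text \<open>
  The product is spelled out on all representatives; \<open>homotopy_group_mult\<close> below recovers
  \<open>[\<alpha>] \<cdot> [\<beta>] = [\<mu> \<circ> (\<alpha>, \<beta>)]\<close>.
\<close>

definition homotopy_group ::
    "'a topology \<Rightarrow> 'b topology \<Rightarrow> ('b \<times> 'b \<Rightarrow> 'b) \<Rightarrow> 'b \<Rightarrow> ('a \<Rightarrow> 'b) set monoid" where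
  "homotopy_group X G \<mu> e =
     \<lparr>carrier = homotopy_class X G ` {\<alpha>. continuous_map X G \<alpha>},
      mult = (\<lambda>a b. \<Union>\<alpha>\<in>a. \<Union>\<beta>\<in>b. homotopy_class X G (\<lambda>x. \<mu> (\<alpha> x, \<beta> x))),
      one = homotopy_class X G (\<lambda>_. e)\<rparr>"

definition homotopic_distance ::
    "'a topology \<Rightarrow> 'b topology \<Rightarrow> nat \<Rightarrow> (nat \<Rightarrow> 'a \<Rightarrow> 'b) \<Rightarrow> enat" where
  "homotopic_distance X G m f =
     Inf {enat n | n. \<exists>U. (\<forall>k\<le>n. openin X (U k)) \<and> (\<Union>k\<le>n. U k) = topspace X \<and>
       (\<forall>k\<le>n. \<forall>i\<in>{1..m}. \<forall>j\<in>{1..m}. homotopic_maps (subtopology X (U k)) G (f i) (f j))}"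

definition categorical_in :: "'a topology \<Rightarrow> 'a set \<Rightarrow> bool" where
  "categorical_in X A \<longleftrightarrow> (\<exists>c. homotopic_maps (subtopology X A) X id (\<lambda>_. c))"

definition LS_cat :: "'a topology \<Rightarrow> enat" where
  "LS_cat X =
     Inf {enat n | n. \<exists>U. (\<forall>k\<le>n. openin X (U k) \<and> categorical_in X (U k)) \<and>
       (\<Union>k\<le>n. U k) = topspace X}"

definition closed_categorical_cover :: "'a topology \<Rightarrow> nat \<Rightarrow> (nat \<Rightarrow> 'a set) \<Rightarrow> bool" where
  "closed_categorical_cover X n A \<longleftrightarrow>
     (\<forall>k\<le>n. closedin X (A k) \<and> categorical_in X (A k)) \<and> (\<Union>k\<le>n. A k) = topspace X"

text \<open>The term \<open>\<Gamma>\<^sub>i\<close>, meaningful for \<open>1 \<le> i \<le> n + 1\<close>; \<open>\<Union>k<i. A k\<close> is \<open>A\<^sub>0 \<union> \<dots> \<union> A\<^sub>i\<^sub>-\<^sub>1\<close>.\<close>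

definition cover_series ::
    "'a topology \<Rightarrow> 'b topology \<Rightarrow> ('b \<times> 'b \<Rightarrow> 'b) \<Rightarrow> 'b \<Rightarrow> (nat \<Rightarrow> 'a set) \<Rightarrow> nat
      \<Rightarrow> ('a \<Rightarrow> 'b) set set" where
  "cover_series X G \<mu> e A i =
     {a \<in> carrier (homotopy_group X G \<mu> e).
        \<exists>\<alpha>. continuous_map X G \<alpha> \<and> a = homotopy_class X G \<alpha> \<and>
          homotopic_maps (subtopology X (\<Union>k<i. A k)) G \<alpha> (\<lambda>_. e)}"

text \<open>
  Depth of an element relative to a finite series \<open>\<Gamma>\<^sub>1 \<supseteq> \<dots> \<supseteq> \<Gamma>\<^sub>N\<close>; the index \<open>j\<close> runs over
  the series only, so the neutral element has depth \<open>N\<close>.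
\<close>

definition series_depth :: "nat \<Rightarrow> (nat \<Rightarrow> 'c set) \<Rightarrow> 'c \<Rightarrow> nat" where
  "series_depth N \<Gamma> x = (THE k. k \<in> {1..N} \<and> x \<in> \<Gamma> k \<and> (\<forall>j\<in>{1..N}. k < j \<longrightarrow> x \<notin> \<Gamma> j))"

lemma homotopy_class_eq_iff:
  assumes "continuous_map X G \<alpha>"
  shows "homotopy_class X G \<alpha> = homotopy_class X G \<beta> \<longleftrightarrow> homotopic_maps X G \<alpha> \<beta>"
proof
  assume "homotopy_class X G \<alpha> = homotopy_class X G \<beta>"
  moreover have "\<alpha> \<in> homotopy_class X G \<alpha>"
    using assms by (simp add: homotopy_class_def)
  ultimately have "homotopic_maps X G \<beta> \<alpha>"
    by (simp add: homotopy_class_def)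
  then show "homotopic_maps X G \<alpha> \<beta>"
    by (rule homotopic_with_symD)
next
  assume h: "homotopic_maps X G \<alpha> \<beta>"
  then have "homotopic_maps X G \<beta> \<alpha>"
    by (rule homotopic_with_symD)
  with h show "homotopy_class X G \<alpha> = homotopy_class X G \<beta>"
    unfolding homotopy_class_def by (blast intro: homotopic_with_trans)
qed

lemma homotopic_maps_pair:
  assumes "homotopic_maps X Y f f'" "homotopic_maps X Z g g'"
  shows "homotopic_maps X (prod_topology Y Z) (\<lambda>x. (f x, g x)) (\<lambda>x. (f' x, g' x))"
proof -
  have "homotopic_maps (prod_topology X X) (prod_topology Y Z)
      (\<lambda>z. (f (fst z), g (snd z))) (\<lambda>z. (f' (fst z), g' (snd z)))"
    using assms by (intro homotopic_with_prod_topology) auto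
  moreover have "continuous_map X (prod_topology X X) (\<lambda>x. (x, x))"
    by (simp add: continuous_map_pairedI)
  ultimately have "homotopic_maps X (prod_topology Y Z)
      ((\<lambda>z. (f (fst z), g (snd z))) \<circ> (\<lambda>x. (x, x)))
      ((\<lambda>z. (f' (fst z), g' (snd z))) \<circ> (\<lambda>x. (x, x)))"
    by (rule homotopic_with_compose_continuous_map_right) auto
  then show ?thesis by (simp add: o_def)
qed

lemma homotopic_maps_compose_right:
  assumes "homotopic_maps Y Z g g'" "continuous_map X Y f"
  shows "homotopic_maps X Z (\<lambda>x. g (f x)) (\<lambda>x. g' (f x))"
  using homotopic_with_compose_continuous_map_right[OF assms, of "\<lambda>_. True"]
  by (simp add: o_def)

lemma homotopic_maps_mult:
  assumes "continuous_map (prod_topology G G) G \<mu>"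
    and "homotopic_maps X G \<alpha> \<alpha>'" "homotopic_maps X G \<beta> \<beta>'"
  shows "homotopic_maps X G (\<lambda>x. \<mu> (\<alpha> x, \<beta> x)) (\<lambda>x. \<mu> (\<alpha>' x, \<beta>' x))"
  using homotopic_with_compose_continuous_map_left
      [OF homotopic_maps_pair[OF assms(2,3)] assms(1), of "\<lambda>_. True"]
  by (simp add: o_def)

lemma homotopy_group_mult:
  assumes \<mu>: "continuous_map (prod_topology G G) G \<mu>"
    and \<alpha>: "continuous_map X G \<alpha>" and \<beta>: "continuous_map X G \<beta>"
  shows "homotopy_class X G \<alpha> \<otimes>\<^bsub>homotopy_group X G \<mu> e\<^esub> homotopy_class X G \<beta>
       = homotopy_class X G (\<lambda>x. \<mu> (\<alpha> x, \<beta> x))"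
proof -
  have const: "homotopy_class X G (\<lambda>x. \<mu> (\<alpha>' x, \<beta>' x)) = homotopy_class X G (\<lambda>x. \<mu> (\<alpha> x, \<beta> x))"
    if "\<alpha>' \<in> homotopy_class X G \<alpha>" "\<beta>' \<in> homotopy_class X G \<beta>" for \<alpha>' \<beta>'
  proof -
    have "homotopic_maps X G (\<lambda>x. \<mu> (\<alpha> x, \<beta> x)) (\<lambda>x. \<mu> (\<alpha>' x, \<beta>' x))"
      using that by (intro homotopic_maps_mult \<mu>) (auto simp: homotopy_class_def)
    then show ?thesis
      using homotopy_class_eq_iff homotopic_with_imp_continuous_maps by metis
  qed
  have mem: "\<alpha> \<in> homotopy_class X G \<alpha>" "\<beta> \<in> homotopy_class X G \<beta>"
    using \<alpha> \<beta> by (auto simp: homotopy_class_def)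
  have "(\<Union>\<alpha>'\<in>homotopy_class X G \<alpha>. \<Union>\<beta>'\<in>homotopy_class X G \<beta>.
           homotopy_class X G (\<lambda>x. \<mu> (\<alpha>' x, \<beta>' x)))
      = (\<Union>\<alpha>'\<in>homotopy_class X G \<alpha>. \<Union>\<beta>'\<in>homotopy_class X G \<beta>.
           homotopy_class X G (\<lambda>x. \<mu> (\<alpha> x, \<beta> x)))"
    by (intro SUP_cong refl const)
  also have "\<dots> = homotopy_class X G (\<lambda>x. \<mu> (\<alpha> x, \<beta> x))"
    using mem by blast
  finally show ?thesis
    by (simp add: homotopy_group_def)
qed

lemma group_homotopy_group:
  assumes "group_like_space G \<mu> e \<eta>"
  shows "group (homotopy_group X G \<mu> e)"
proof -
  let ?\<G> = "homotopy_group X G \<mu> e" and ?c = "homotopy_class X G"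
  have \<mu>: "continuous_map (prod_topology G G) G \<mu>" and e: "continuous_map X G (\<lambda>_. e)"
    and unit: "homotopic_maps G G (\<lambda>x. \<mu> (e, x)) id"
    and assoc: "homotopic_maps (prod_topology G (prod_topology G G)) G
       (\<lambda>(x, y, z). \<mu> (\<mu> (x, y), z)) (\<lambda>(x, y, z). \<mu> (x, \<mu> (y, z)))"
    and \<eta>: "continuous_map G G \<eta>"
    and inv: "homotopic_maps G G (\<lambda>x. \<mu> (\<eta> x, x)) (\<lambda>_. e)"
    using assms by (auto simp: group_like_space_def H_space_def)
  have cont: "continuous_map X G (\<lambda>x. \<mu> (\<alpha> x, \<beta> x))"
    if "continuous_map X G \<alpha>" "continuous_map X G \<beta>" for \<alpha> \<beta>
    using continuous_map_compose[OF continuous_map_pairedI[OF that] \<mu>] by (simp add: o_def)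
  have eqI: "?c \<alpha> = ?c \<beta>" if "homotopic_maps X G \<alpha> \<beta>" for \<alpha> \<beta>
    using that homotopy_class_eq_iff homotopic_with_imp_continuous_maps by metis
  have carr: "carrier ?\<G> = ?c ` {\<alpha>. continuous_map X G \<alpha>}" and one: "\<one>\<^bsub>?\<G>\<^esub> = ?c (\<lambda>_. e)"
    by (simp_all add: homotopy_group_def)
  note mult = homotopy_group_mult[OF \<mu>, of X _ _ e]
  show ?thesis
  proof (rule groupI)
    fix a b assume "a \<in> carrier ?\<G>" "b \<in> carrier ?\<G>"
    then show "a \<otimes>\<^bsub>?\<G>\<^esub> b \<in> carrier ?\<G>"
      unfolding carr using mult cont by auto
  next
    show "\<one>\<^bsub>?\<G>\<^esub> \<in> carrier ?\<G>"
      unfolding carr one using e by blast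
  next
    fix a b c assume "a \<in> carrier ?\<G>" "b \<in> carrier ?\<G>" "c \<in> carrier ?\<G>"
    then obtain \<alpha> \<beta> \<gamma> where
      *: "continuous_map X G \<alpha>" "continuous_map X G \<beta>" "continuous_map X G \<gamma>"
      and [simp]: "a = ?c \<alpha>" "b = ?c \<beta>" "c = ?c \<gamma>"
      unfolding carr by blast
    have "homotopic_maps X G (\<lambda>x. \<mu> (\<mu> (\<alpha> x, \<beta> x), \<gamma> x)) (\<lambda>x. \<mu> (\<alpha> x, \<mu> (\<beta> x, \<gamma> x)))"
      using homotopic_maps_compose_right[OF assoc, of X "\<lambda>x. (\<alpha> x, \<beta> x, \<gamma> x)"] *
      by (simp add: continuous_map_pairedI)
    from eqI[OF this] show "a \<otimes>\<^bsub>?\<G>\<^esub> b \<otimes>\<^bsub>?\<G>\<^esub> c = a \<otimes>\<^bsub>?\<G>\<^esub> (b \<otimes>\<^bsub>?\<G>\<^esub> c)"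
      using * by (simp add: mult cont)
  next
    fix a assume "a \<in> carrier ?\<G>"
    then obtain \<alpha> where *: "continuous_map X G \<alpha>" and [simp]: "a = ?c \<alpha>"
      unfolding carr by blast
    have "homotopic_maps X G (\<lambda>x. \<mu> (e, \<alpha> x)) \<alpha>"
      using homotopic_maps_compose_right[OF unit *] by simp
    from eqI[OF this] show "\<one>\<^bsub>?\<G>\<^esub> \<otimes>\<^bsub>?\<G>\<^esub> a = a"
      using * e by (simp add: mult one)
    have **: "continuous_map X G (\<lambda>x. \<eta> (\<alpha> x))"
      using continuous_map_compose[OF * \<eta>] by (simp add: o_def)
    have "homotopic_maps X G (\<lambda>x. \<mu> (\<eta> (\<alpha> x), \<alpha> x)) (\<lambda>_. e)"
      using homotopic_maps_compose_right[OF inv *] .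
    from eqI[OF this] have "?c (\<lambda>x. \<eta> (\<alpha> x)) \<otimes>\<^bsub>?\<G>\<^esub> a = \<one>\<^bsub>?\<G>\<^esub>"
      using * ** by (simp add: mult one)
    then show "\<exists>b\<in>carrier ?\<G>. b \<otimes>\<^bsub>?\<G>\<^esub> a = \<one>\<^bsub>?\<G>\<^esub>"
      unfolding carr using ** by blast
  qed
qed

end

theory Submission
  imports Defs
begin

text \<open>
  Let \<open>k\<close> be the least depth of the \<open>f i\<close>. Every \<open>f i\<close> is null-homotopic on
  \<open>C = A\<^sub>0 \<union> \<dots> \<union> A\<^sub>k\<^sub>-\<^sub>1\<close>, and on each of the remaining sets \<open>A\<^sub>k, \<dots>, A\<^sub>n\<close>, because up to
  homotopy it is constant there and \<open>G\<close> is path-connected. This is a closed cover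
  with \<open>n - k + 2\<close> members on which all the \<open>f i\<close> agree up to homotopy. It remains to make the
  cover open.

  There is no reason why the \<open>f i\<close> should be null-homotopic near \<open>C\<close>: a homotopy on \<open>C\<close> takes
  values in \<open>G\<close>, whose local structure is arbitrary. Instead \<open>C\<close> is shrunk to the open set
  \<open>X - (A\<^sub>k \<union> \<dots> \<union> A\<^sub>n)\<close>, which is contained in \<open>C\<close> since the \<open>A\<^sub>j\<close> cover \<open>X\<close>, and only the
  sets \<open>A\<^sub>k, \<dots>, A\<^sub>n\<close> are enlarged. Their contractions take values in the ANR \<open>X\<close>, so each of
  them has an open categorical neighbourhood (\<open>ANR_closed_categorical_neighbourhood\<close>). The
  resulting open cover is the one in \<open>homotopic_distance_le_of_null_on_union\<close>.

  The neighbourhood of a closed categorical set \<open>A\<close> comes from extending the map that is the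
  contraction on \<open>[0,1] \<times> A\<close>, the identity on \<open>{0} \<times> X\<close> and constant on \<open>{1} \<times> X\<close> to a
  neighbourhood of its domain in \<open>[0,1] \<times> X\<close>. Retractions of neighbourhoods in suitable ambient
  spaces yield such extensions (\<open>ANR_neighbourhood_extension\<close>): \<open>X\<close> is embedded isometrically in
  the functions \<open>X \<Rightarrow> real\<close> with the uniform metric, a map into that function space is extended
  by Hausdorff's formula (\<open>Hausdorff_extension\<close>), and the distance to the domain is added as a
  further coordinate, so that the image of \<open>X\<close> becomes closed.
\<close>

section \<open>The uniform metric on real functions\<close>

text \<open>
  Truncating at 1 makes this a metric on all functions, without a restriction to bounded ones.
\<close>

definition uniform_dist :: "('i \<Rightarrow> real) \<Rightarrow> ('i \<Rightarrow> real) \<Rightarrow> real" where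
  "uniform_dist u v = (SUP i. min 1 \<bar>u i - v i\<bar>)"

lemma uniform_dist_le: "(\<And>i. \<bar>u i - v i\<bar> \<le> r) \<Longrightarrow> uniform_dist u v \<le> r"
  unfolding uniform_dist_def by (rule cSUP_least) (auto simp: min_le_iff_disj)

lemma coordinate_le_uniform_dist: "min 1 \<bar>u i - v i\<bar> \<le> uniform_dist u v"
  unfolding uniform_dist_def by (rule cSUP_upper) (auto intro!: bdd_aboveI[of _ 1])

lemma Metric_space_uniform_dist: "Metric_space UNIV uniform_dist"
proof
  fix u v w :: "'i \<Rightarrow> real"
  have nonneg: "0 \<le> uniform_dist u v" for u v :: "'i \<Rightarrow> real"
    using coordinate_le_uniform_dist[of u undefined v] by (simp add: min_def split: if_splits)
  show "0 \<le> uniform_dist u v" by (rule nonneg)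
  show "uniform_dist u v = uniform_dist v u"
    by (simp add: uniform_dist_def abs_minus_commute)
  show "uniform_dist u v = 0 \<longleftrightarrow> u = v"
  proof
    assume eq0: "uniform_dist u v = 0"
    show "u = v"
    proof
      show "u i = v i" for i
        using coordinate_le_uniform_dist[of u i v] eq0 by (simp add: min_le_iff_disj)
    qed
  qed (simp add: uniform_dist_def)
  show "uniform_dist u w \<le> uniform_dist u v + uniform_dist v w"
    unfolding uniform_dist_def[of u w]
  proof (rule cSUP_least)
    show "min 1 \<bar>u i - w i\<bar> \<le> uniform_dist u v + uniform_dist v w" for i
      using coordinate_le_uniform_dist[of u i v] coordinate_le_uniform_dist[of v i w]
        nonneg[of u v] nonneg[of v w]
      by linarith
  qed simp
qed

abbreviation uniform_topology :: "('i \<Rightarrow> real) topology" where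
  "uniform_topology \<equiv> Metric_space.mtopology UNIV uniform_dist"

lemma topspace_uniform_topology [simp]: "topspace uniform_topology = UNIV"
  by (simp add: Metric_space.topspace_mtopology Metric_space_uniform_dist)

lemma metrizable_uniform_topology: "metrizable_space uniform_topology"
  using Metric_space.metrizable_space_mtopology[OF Metric_space_uniform_dist] .

section \<open>Hausdorff's extension formula\<close>

text \<open>
  With weight 1 this is the distance from \<open>z\<close> to \<open>B\<close>. Hausdorff's formula divides the infimum
  for the weight given by a function on \<open>B\<close> by this distance. If the
  weights lie between 1 and 2, points of \<open>B\<close> more than twice as far from \<open>z\<close> as \<open>B\<close> itself do not
  influence the quotient.
\<close>

definition weighted_infdist :: "('z \<Rightarrow> 'z \<Rightarrow> real) \<Rightarrow> 'z set \<Rightarrow> ('z \<Rightarrow> real) \<Rightarrow> 'z \<Rightarrow> real" where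
  "weighted_infdist d B w z = (INF b\<in>B. w b * d z b)"

lemma quotient_close:
  fixes N N' D D' r :: real
  assumes "0 < D" "r \<le> D / 2" "\<bar>N' - N\<bar> \<le> 2 * r" "\<bar>D' - D\<bar> \<le> r" "0 \<le> N" "N \<le> 2 * D"
  shows "\<bar>N' / D' - N / D\<bar> \<le> 8 * r / D"
proof -
  have D': "D / 2 \<le> D'" "0 < D'"
    using assms by linarith+
  have r: "0 \<le> r" using assms by linarith
  have "\<bar>N' * D - N * D'\<bar> = \<bar>(N' - N) * D + N * (D - D')\<bar>"
    by (simp add: algebra_simps)
  also have "\<dots> \<le> \<bar>N' - N\<bar> * D + N * \<bar>D - D'\<bar>"
    using assms abs_triangle_ineq[of "(N' - N) * D" "N * (D - D')"] by (simp add: abs_mult)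
  also have "\<dots> \<le> (2 * r) * D + (2 * D) * r"
    using assms by (intro add_mono mult_mono) auto
  also have "\<dots> = 8 * r * (D / 2)" by simp
  also have "\<dots> \<le> 8 * r * D'"
    using D' r by (intro mult_left_mono) auto
  finally have "\<bar>N' * D - N * D'\<bar> \<le> 8 * r * D'" .
  then have "\<bar>N' * D - N * D'\<bar> / (D' * D) \<le> 8 * r * D' / (D' * D)"
    using assms(1) D' by (intro divide_right_mono) auto
  moreover have "N' / D' - N / D = (N' * D - N * D') / (D' * D)"
    using assms(1) D' by (simp add: field_simps)
  ultimately show ?thesis
    using assms(1) D' by (simp add: abs_mult)
qed

context Metric_space
begin

lemma weighted_infdist_le:
  assumes "b \<in> B" "\<And>b. b \<in> B \<Longrightarrow> 0 \<le> w b"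
  shows "weighted_infdist d B w z \<le> w b * d z b"
  unfolding weighted_infdist_def
  by (rule cINF_lower) (use assms in \<open>auto intro!: bdd_belowI[of _ 0]\<close>)

lemma weighted_infdist_greatest:
  assumes "B \<noteq> {}" "\<And>b. b \<in> B \<Longrightarrow> r \<le> w b * d z b"
  shows "r \<le> weighted_infdist d B w z"
  unfolding weighted_infdist_def using assms by (intro cINF_greatest) auto

lemma weighted_infdist_Lipschitz:
  assumes B: "B \<subseteq> M" "B \<noteq> {}" and w: "\<And>b. b \<in> B \<Longrightarrow> 0 \<le> w b \<and> w b \<le> C"
    and y: "y \<in> M" and z: "z \<in> M"
  shows "\<bar>weighted_infdist d B w y - weighted_infdist d B w z\<bar> \<le> C * d y z"
proof -
  have *: "weighted_infdist d B w y \<le> weighted_infdist d B w z + C * d y z"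
    if y: "y \<in> M" and z: "z \<in> M" for y z
  proof -
    have "weighted_infdist d B w y - C * d y z \<le> w b * d z b" if b: "b \<in> B" for b
    proof -
      have "weighted_infdist d B w y \<le> w b * d y b"
        using weighted_infdist_le[OF b] w by blast
      also have "\<dots> \<le> w b * (d y z + d z b)"
        using b B w y z triangle by (intro mult_left_mono) auto
      also have "\<dots> \<le> C * d y z + w b * d z b"
        using w[OF b] by (simp add: distrib_left mult_right_mono)
      finally show ?thesis by simp
    qed
    then have "weighted_infdist d B w y - C * d y z \<le> weighted_infdist d B w z"
      using B by (intro weighted_infdist_greatest) auto
    then show ?thesis by simp
  qed
  show ?thesis
    using *[OF y z] *[OF z y] by (simp add: commute abs_le_iff)
qed

lemma weighted_infdist_pos:
  assumes B: "closedin mtopology B" "B \<noteq> {}" and w: "\<And>b. b \<in> B \<Longrightarrow> 1 \<le> w b"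
    and z: "z \<in> M - B"
  shows "0 < weighted_infdist d B w z"
proof -
  have "openin mtopology (M - B)"
    using B by (simp add: closedin_def)
  then obtain r where r: "r > 0" "mball z r \<subseteq> M - B"
    using z by (auto simp: openin_mtopology)
  have BM: "B \<subseteq> M"
    using B closedin_subset by fastforce
  have "r \<le> w b * d z b" if b: "b \<in> B" for b
  proof -
    have "r \<le> d z b"
      using r b BM z by (force simp: not_le)
    also have "\<dots> \<le> w b * d z b"
      using mult_right_mono[OF w[OF b], of "d z b"] by simp
    finally show ?thesis .
  qed
  then have "r \<le> weighted_infdist d B w z"
    using B by (intro weighted_infdist_greatest)
  with r show ?thesis by simp
qed

text \<open>
  The extension is \<open>(INF b\<in>B. (1 + \<phi> b i) * d z b) / (INF b\<in>B. d z b) - 1\<close> in coordinate \<open>i\<close>.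
  The shift by 1 keeps the weights between 1 and 2. The formula is applied to all coordinates at
  once; that the result is continuous for the uniform metric holds because no estimate below
  depends on \<open>i\<close>. Away from \<open>B\<close>, numerator and denominator are Lipschitz with constants 2 and 1.
  Near a point of \<open>B\<close>, only nearby points of \<open>B\<close> matter for the infimum, and on them
  \<open>\<phi>\<close> is almost constant.
\<close>

lemma Hausdorff_extension:
  fixes \<phi> :: "'a \<Rightarrow> 'i \<Rightarrow> real"
  assumes B: "closedin mtopology B" "B \<noteq> {}"
    and cont: "continuous_map (subtopology mtopology B) uniform_topology \<phi>"
    and bounds: "\<And>b i. b \<in> B \<Longrightarrow> 0 \<le> \<phi> b i \<and> \<phi> b i \<le> 1"
  obtains F where "continuous_map mtopology uniform_topology F" "\<And>b. b \<in> B \<Longrightarrow> F b = \<phi> b"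
proof
  let ?D = "weighted_infdist d B (\<lambda>_. 1)"
  let ?N = "\<lambda>z i. weighted_infdist d B (\<lambda>b. 1 + \<phi> b i) z"
  define F where "F z = (if z \<in> B then \<phi> z else (\<lambda>i. ?N z i / ?D z - 1))" for z
  show "F b = \<phi> b" if "b \<in> B" for b
    using that by (simp add: F_def)
  have BM: "B \<subseteq> M"
    using B closedin_subset by fastforce
  have D_le: "?D z \<le> d z b" if "b \<in> B" for b z
    using weighted_infdist_le[OF that, of "\<lambda>_. 1"] by simp
  have D_pos: "0 < ?D z" if "z \<in> M - B" for z
    using weighted_infdist_pos[OF B _ that] by simp
  have N_le: "?N z i \<le> (1 + \<phi> b i) * d z b" if "b \<in> B" for z i b
    using bounds by (intro weighted_infdist_le that) (simp add: add_nonneg_nonneg)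
  have N_D: "0 \<le> ?N z i" "?N z i \<le> 2 * ?D z" for z i
  proof -
    show "0 \<le> ?N z i"
      using B bounds by (intro weighted_infdist_greatest) (auto intro!: mult_nonneg_nonneg add_nonneg_nonneg)
    have "?N z i / 2 \<le> ?D z"
    proof (rule weighted_infdist_greatest)
      fix b assume b: "b \<in> B"
      have "?N z i \<le> 2 * d z b"
        using N_le[OF b, of i z] mult_right_mono[of "1 + \<phi> b i" 2 "d z b"] bounds[OF b, of i] by simp
      then show "?N z i / 2 \<le> 1 * d z b" by simp
    qed (use B in auto)
    then show "?N z i \<le> 2 * ?D z" by simp
  qed
  have key: "\<exists>r>0. \<forall>y\<in>M. d z y < r \<longrightarrow> (\<forall>i. \<bar>F z i - F y i\<bar> \<le> \<epsilon>)"
    if z: "z \<in> M" and \<epsilon>: "0 < \<epsilon>" "\<epsilon> \<le> 1" for z \<epsilon>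
  proof (cases "z \<in> B")
    case False
    \<comment> \<open>The first bound keeps the ball away from \<open>B\<close>, the second comes from \<open>quotient_close\<close>.\<close>
    let ?r = "min (?D z / 2) (\<epsilon> * ?D z / 8)"
    have Dz: "0 < ?D z" using D_pos z False by blast
    show ?thesis
    proof (intro exI[of _ ?r] conjI ballI impI allI)
      show "0 < ?r" using Dz \<epsilon> by simp
      fix y i assume y: "y \<in> M" and r: "d z y < ?r"
      have "\<not> ?D z \<le> d z y" using r Dz by simp
      then have yB: "y \<notin> B" using D_le by blast
      have "\<bar>?N y i / ?D y - ?N z i / ?D z\<bar> \<le> 8 * d z y / ?D z"
      proof (rule quotient_close)
        show "\<bar>?N y i - ?N z i\<bar> \<le> 2 * d z y"
          using weighted_infdist_Lipschitz[OF BM B(2) _ y z, of "\<lambda>b. 1 + \<phi> b i" 2] bounds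
          by (simp add: commute add_nonneg_nonneg)
        show "\<bar>?D y - ?D z\<bar> \<le> d z y"
          using weighted_infdist_Lipschitz[OF BM B(2) _ y z, of "\<lambda>b. 1" 1]
          by (simp add: commute)
      qed (use Dz r N_D in auto)
      also have "\<dots> \<le> \<epsilon>"
        using r Dz by (simp add: divide_simps)
      finally show "\<bar>F z i - F y i\<bar> \<le> \<epsilon>"
        using False yB by (simp add: F_def abs_minus_commute)
    qed
  next
    case True
    \<comment> \<open>The upper estimate below collects an error of \<open>4 * \<delta>\<close>.\<close>
    define \<delta> where "\<delta> = \<epsilon> / 4"
    have \<delta>: "0 < \<delta>" "\<delta> \<le> 1/4" using \<epsilon> by (auto simp: \<delta>_def)
    interpret B: Submetric M d B
      by unfold_locales (rule BM)
    have "\<forall>\<epsilon>>0. \<exists>\<eta>>0. \<forall>b. b \<in> B \<and> d z b < \<eta> \<longrightarrow> uniform_dist (\<phi> z) (\<phi> b) < \<epsilon>"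
      using cont True unfolding B.mtopology_submetric[symmetric]
        B.sub.metric_continuous_map[OF Metric_space_uniform_dist]
      by (elim conjE) (erule bspec)
    then obtain \<eta> where \<eta>: "\<eta> > 0"
      and near: "\<And>b. b \<in> B \<Longrightarrow> d z b < \<eta> \<Longrightarrow> uniform_dist (\<phi> z) (\<phi> b) < \<delta>"
      using \<delta>(1) by meson
    have close: "\<bar>\<phi> z i - \<phi> b i\<bar> < \<delta>" if "b \<in> B" "d z b < \<eta>" for b i
      using near[OF that] coordinate_le_uniform_dist[of "\<phi> z" i "\<phi> b"] \<delta> by linarith
    show ?thesis
    proof (intro exI[of _ "\<eta> / 4"] conjI ballI impI allI)
      show "0 < \<eta> / 4" using \<eta> by simp
      fix y i assume y: "y \<in> M" and r: "d z y < \<eta> / 4"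
      show "\<bar>F z i - F y i\<bar> \<le> \<epsilon>"
      proof (cases "y \<in> B")
        case yB: True
        then show ?thesis
          using close[OF yB, of i] True r \<eta> \<epsilon> by (simp add: F_def \<delta>_def)
      next
        case yB: False
        have Dy: "0 < ?D y" using D_pos y yB by blast
        have Dyz: "?D y \<le> d z y" using D_le[OF True, of y] by (simp add: commute)
        have tri: "d z b \<le> d z y + d y b" "d y b \<le> d z y + d z b" if "b \<in> B" for b
          using triangle[OF z y, of b] triangle[OF y z, of b] that BM by (auto simp: commute)
        have "(1 + \<phi> z i - \<delta>) * ?D y \<le> ?N y i"
        proof (rule weighted_infdist_greatest)
          fix b assume b: "b \<in> B"
          show "(1 + \<phi> z i - \<delta>) * ?D y \<le> (1 + \<phi> b i) * d y b"
          proof (cases "d z b < \<eta>")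
            case True
            have "(1 + \<phi> z i - \<delta>) * ?D y \<le> (1 + \<phi> b i) * ?D y"
              using close[OF b True, of i] Dy by (intro mult_right_mono) auto
            also have "\<dots> \<le> (1 + \<phi> b i) * d y b"
              using D_le[OF b] bounds[OF b, of i] by (intro mult_left_mono) auto
            finally show ?thesis .
          next
            case False
            \<comment> \<open>Such a \<open>b\<close> has distance more than \<open>3 * \<eta> / 4\<close> from \<open>y\<close>, too far for the infimum.\<close>
            have "(1 + \<phi> z i - \<delta>) * ?D y \<le> 2 * ?D y"
              using bounds[OF True, of i] \<delta> Dy by (intro mult_right_mono) auto
            also have "\<dots> \<le> d y b"
              using Dyz r tri(1)[OF b] False \<eta> by linarith
            also have "\<dots> \<le> (1 + \<phi> b i) * d y b"
              using bounds[OF b, of i] mult_right_mono[of 1 "1 + \<phi> b i" "d y b"] by simp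
            finally show ?thesis .
          qed
        qed (use B in auto)
        then have lower: "1 + \<phi> z i - \<delta> \<le> ?N y i / ?D y"
          using Dy by (simp add: pos_le_divide_eq)
        \<comment> \<open>For the upper bound, an almost nearest point of \<open>B\<close> is used; it lies in the \<open>\<eta>\<close>-ball.\<close>
        have "\<exists>b\<in>B. 1 * d y b < (1 + \<delta>) * ?D y"
        proof (rule ccontr)
          assume "\<not> ?thesis"
          then have "(1 + \<delta>) * ?D y \<le> ?D y"
            using B by (intro weighted_infdist_greatest) (auto simp: not_less)
          with Dy \<delta> show False by (simp add: algebra_simps mult_le_0_iff)
        qed
        then obtain b where b: "b \<in> B" and db: "d y b < (1 + \<delta>) * ?D y" by auto
        have "(1 + \<delta>) * ?D y \<le> 2 * ?D y"
          using \<delta> Dy by (intro mult_right_mono) auto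
        then have "d z b < \<eta>"
          using db Dyz r tri(1)[OF b] \<eta> by linarith
        from close[OF b this, of i] have phib: "\<phi> b i \<le> \<phi> z i + \<delta>"
          by (simp add: abs_less_iff)
        have "?N y i \<le> (1 + \<phi> b i) * d y b" using N_le[OF b] .
        also have "\<dots> \<le> (1 + \<phi> z i + \<delta>) * ((1 + \<delta>) * ?D y)"
          using phib db bounds[OF b, of i] Dy by (intro mult_mono) auto
        finally have "?N y i / ?D y \<le> (1 + \<phi> z i + \<delta>) * (1 + \<delta>)"
          using Dy by (simp add: pos_divide_le_eq mult.assoc)
        also have "\<dots> = 1 + \<phi> z i + \<delta> + (1 + \<phi> z i + \<delta>) * \<delta>"
          by (simp add: algebra_simps)
        also have "\<dots> \<le> 1 + \<phi> z i + \<delta> + 3 * \<delta>"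
          using bounds[OF True, of i] \<delta> by (intro add_left_mono mult_right_mono) auto
        finally show ?thesis
          using lower True yB \<delta> unfolding F_def \<delta>_def by (simp add: abs_le_iff)
      qed
    qed
  qed
  show "continuous_map mtopology uniform_topology F"
    unfolding metric_continuous_map[OF Metric_space_uniform_dist]
  proof (intro conjI ballI allI impI)
    fix z and \<epsilon> :: real assume z: "z \<in> M" and \<epsilon>: "\<epsilon> > 0"
    obtain r where r: "r > 0" "\<And>y i. y \<in> M \<Longrightarrow> d z y < r \<Longrightarrow> \<bar>F z i - F y i\<bar> \<le> min 1 (\<epsilon> / 2)"
      using key[OF z, of "min 1 (\<epsilon> / 2)"] \<epsilon> by auto
    have "uniform_dist (F z) (F y) < \<epsilon>" if "y \<in> M" "d z y < r" for y
    proof -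
      have "uniform_dist (F z) (F y) \<le> min 1 (\<epsilon> / 2)"
        using r(2)[OF that] by (rule uniform_dist_le)
      then show ?thesis using \<epsilon> by auto
    qed
    then show "\<exists>r>0. \<forall>y. y \<in> M \<and> d z y < r \<longrightarrow> uniform_dist (F z) (F y) < \<epsilon>"
      using r(1) by blast
  qed simp
qed

end

section \<open>Neighbourhood extension of maps into an ANR\<close>

text \<open>
  A point goes to its distance function, for the metric capped at 1, which takes values in \<open>[0,1]\<close>
  as Hausdorff's formula requires. By the triangle inequality the uniform distance of two such
  functions is at most the distance of the points, and it is attained at one of them.
\<close>

lemma Kuratowski_embedding:
  assumes "metrizable_space X"
  obtains k :: "'a \<Rightarrow> 'a \<Rightarrow> real" and g where
    "homeomorphic_maps X (subtopology uniform_topology (k ` topspace X)) k g"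
    "\<And>x y. x \<in> topspace X \<Longrightarrow> 0 \<le> k x y \<and> k x y \<le> 1"
proof -
  obtain M d where "Metric_space M d" and X: "X = Metric_space.mtopology M d"
    using assms unfolding metrizable_space_def by blast
  then interpret Metric_space M d by simp
  let ?c = "capped_dist 1"
  interpret Cap: Metric_space M ?c by (rule capped_dist)
  have XC: "X = Cap.mtopology"
    by (simp add: X mtopology_capped_metric)
  define k where "k x y = (if y \<in> M then ?c x y else 0)" for x y
  interpret Metric_space12 M ?c UNIV uniform_dist
    by (simp add: Metric_space12_def Cap.Metric_space_axioms Metric_space_uniform_dist)
  have iso: "uniform_dist (k x) (k y) = ?c x y" if x: "x \<in> M" and y: "y \<in> M" for x y
  proof (rule antisym)
    show "uniform_dist (k x) (k y) \<le> ?c x y"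
    proof (rule uniform_dist_le)
      show "\<bar>k x i - k y i\<bar> \<le> ?c x y" for i
        using Cap.mdist_reverse_triangle[OF x _ y, of i] Cap.triangle[OF x y, of i]
          Cap.triangle[OF y x, of i] Cap.commute[of x y]
        by (auto simp: k_def abs_le_iff)
    qed
    show "?c x y \<le> uniform_dist (k x) (k y)"
      using coordinate_le_uniform_dist[of "k x" y "k y"] y
      by (auto simp: k_def capped_dist_def)
  qed
  have "embedding_map X uniform_topology k"
    unfolding XC by (rule isometry_imp_embedding_map) (auto simp: iso)
  then obtain g where "homeomorphic_maps X (subtopology uniform_topology (k ` topspace X)) k g"
    by (auto simp: embedding_map_def homeomorphic_map_maps)
  moreover have "0 \<le> k x y \<and> k x y \<le> 1" for x y
    by (simp add: k_def capped_dist_def)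
  ultimately show thesis using that by blast
qed

lemma ANR_space_imp_metrizable: "ANR_space X \<Longrightarrow> metrizable_space X"
  by (simp add: ANR_space_def)

lemma ANR_space_retract:
  fixes X :: "'a topology" and Y :: "(('a \<Rightarrow> real) \<times> real) topology"
  assumes "ANR_space X" "metrizable_space Y" "closedin Y S" "subtopology Y S homeomorphic_space X"
  obtains U where "openin Y U" "S retract_of_space subtopology Y U"
  using assms unfolding ANR_space_def by (elim conjE allE[of _ Y] allE[of _ S]) auto

text \<open>
  In \<open>Y = K \<times> {0} \<union> UNIV \<times> {0<..}\<close> the copy \<open>K \<times> {0}\<close> of \<open>X\<close> is closed, even if \<open>K\<close> is
  not closed in the function space, so it is a retract of a neighbourhood \<open>U\<close> in \<open>Y\<close>. The map
  \<open>E\<close> that pairs a Hausdorff extension of \<open>h\<close> with the distance to \<open>B\<close> takes values in \<open>Y\<close>;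
  on the preimage of \<open>U\<close> the retraction brings these values back to \<open>X\<close>.
\<close>

lemma ANR_neighbourhood_extension:
  assumes ANR: "ANR_space X" and Z: "metrizable_space Z" and B: "closedin Z B"
    and h: "continuous_map (subtopology Z B) X h"
  obtains V g where "openin Z V" "B \<subseteq> V" "continuous_map (subtopology Z V) X g"
    "\<And>z. z \<in> B \<Longrightarrow> g z = h z"
proof (cases "B = {}")
  case True
  have "continuous_map (subtopology Z {}) X h" by (simp add: continuous_map_on_empty)
  then show ?thesis using True that[of "{}" h] by simp
next
  case False
  obtain k :: "'a \<Rightarrow> 'a \<Rightarrow> real" and k' where
    kk': "homeomorphic_maps X (subtopology uniform_topology (k ` topspace X)) k k'"
    and k01: "\<And>x y. x \<in> topspace X \<Longrightarrow> 0 \<le> k x y \<and> k x y \<le> 1"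
    using Kuratowski_embedding[OF ANR_space_imp_metrizable[OF ANR]] by blast
  have k: "continuous_map X uniform_topology k"
    and k': "continuous_map (subtopology uniform_topology (k ` topspace X)) X k'"
    and inv: "\<And>x. x \<in> topspace X \<Longrightarrow> k' (k x) = x"
    using kk' by (auto simp: homeomorphic_maps_def continuous_map_in_subtopology)
  let ?K = "k ` topspace X"
  let ?P = "prod_topology (uniform_topology :: ('a \<Rightarrow> real) topology) euclideanreal"
  let ?S = "?K \<times> {0::real}"
  define Y where "Y = subtopology ?P (?S \<union> UNIV \<times> {0<..})"
  have Y: "metrizable_space Y"
    unfolding Y_def
    by (simp add: metrizable_space_subtopology metrizable_space_prod_topology
        metrizable_uniform_topology metrizable_space_euclidean)
  have SY: "closedin Y ?S"
  proof -
    have "closedin ?P (UNIV \<times> {0})"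
      by (simp add: closedin_prod_Times_iff closedin_topspace[of uniform_topology, simplified])
    moreover have "?S = UNIV \<times> {0} \<inter> (?S \<union> UNIV \<times> {0<..})" by auto
    ultimately show ?thesis
      unfolding Y_def closedin_subtopology by blast
  qed
  have YS: "subtopology Y ?S = subtopology ?P ?S"
    by (simp add: Y_def subtopology_subtopology inf_absorb2)
  have fst_S: "continuous_map (subtopology Y ?S) X (k' \<circ> fst)"
    unfolding YS
  proof (rule continuous_map_compose[OF _ k'])
    show "continuous_map (subtopology ?P ?S) (subtopology uniform_topology ?K) fst"
      by (auto simp: continuous_map_in_subtopology continuous_map_from_subtopology continuous_map_fst)
  qed
  have "homeomorphic_maps X (subtopology Y ?S) (\<lambda>x. (k x, 0)) (k' \<circ> fst)"
    unfolding homeomorphic_maps_def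
  proof (intro conjI ballI)
    show "continuous_map X (subtopology Y ?S) (\<lambda>x. (k x, 0))"
      unfolding YS continuous_map_in_subtopology using k by (auto intro: continuous_map_pairedI)
    show "continuous_map (subtopology Y ?S) X (k' \<circ> fst)" by (rule fst_S)
    show "(k' \<circ> fst) (k x, 0) = x" if "x \<in> topspace X" for x
      using inv[OF that] by simp
    show "(k ((k' \<circ> fst) y), 0) = y" if "y \<in> topspace (subtopology Y ?S)" for y
      using that inv unfolding YS by auto
  qed
  then have "subtopology Y ?S homeomorphic_space X"
    using homeomorphic_space_def homeomorphic_space_sym by blast
  then obtain U where U: "openin Y U" and "?S retract_of_space subtopology Y U"
    using ANR_space_retract[OF ANR Y SY] by blast
  then obtain r where r: "continuous_map (subtopology Y U) (subtopology (subtopology Y U) ?S) r"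
    and r_id: "\<And>s. s \<in> ?S \<Longrightarrow> r s = s" and SU: "?S \<subseteq> U"
    by (auto simp: retract_of_space_def)
  have r': "continuous_map (subtopology Y U) (subtopology Y ?S) r"
    using r SU by (simp add: subtopology_subtopology inf_absorb2)
  obtain M d where "Metric_space M d" and ZM: "Z = Metric_space.mtopology M d"
    using Z unfolding metrizable_space_def by blast
  then interpret Metric_space M d by simp
  have Bc: "closedin mtopology B" using B ZM by simp
  have hX: "h b \<in> topspace X" if "b \<in> B" for b
    using h that B closedin_subset[OF B] by (auto simp: continuous_map_def)
  have "continuous_map (subtopology mtopology B) uniform_topology (k \<circ> h)"
    using continuous_map_compose[OF h k] ZM by simp
  moreover have "0 \<le> (k \<circ> h) b i \<and> (k \<circ> h) b i \<le> 1" if "b \<in> B" for b i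
    using k01 hX[OF that] by simp
  ultimately obtain F where F: "continuous_map mtopology uniform_topology F"
    and FB: "\<And>b. b \<in> B \<Longrightarrow> F b = (k \<circ> h) b"
    using Hausdorff_extension[OF Bc False, of "k \<circ> h"] by blast
  let ?D = "weighted_infdist d B (\<lambda>_. 1)"
  have BM: "B \<subseteq> M" using closedin_subset[OF Bc] by simp
  have D_pos: "0 < ?D z" if "z \<in> M - B" for z
    using weighted_infdist_pos[OF Bc False _ that] by simp
  have D_0: "?D b = 0" if "b \<in> B" for b
  proof (rule antisym)
    show "?D b \<le> 0"
      using weighted_infdist_le[OF that, of "\<lambda>_. 1" b] that BM by auto
    show "0 \<le> ?D b"
      by (rule weighted_infdist_greatest) (use False in auto)
  qed
  have D: "continuous_map mtopology euclideanreal ?D"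
  proof -
    have "\<bar>?D y - ?D z\<bar> \<le> 1 * d y z" if "y \<in> M" "z \<in> M" for y z
      using weighted_infdist_Lipschitz[OF BM False _ that, of "\<lambda>_. 1" 1] by simp
    then have "dist (?D y) (?D z) \<le> d y z" if "y \<in> M" "z \<in> M" for y z
      using that by (simp add: dist_real_def)
    then have "continuous_map mtopology Met_TC.mtopology ?D"
      unfolding metric_continuous_map[OF Met_TC.Metric_space_axioms]
      by (auto intro: le_less_trans)
    then show ?thesis by simp
  qed
  define E where "E z = (F z, ?D z)" for z
  have E: "continuous_map mtopology Y E"
    unfolding Y_def E_def continuous_map_in_subtopology
  proof
    show "continuous_map mtopology ?P (\<lambda>z. (F z, ?D z))"
      using F D by (rule continuous_map_pairedI)
    have "(F z, ?D z) \<in> ?S \<union> UNIV \<times> {0<..}" if "z \<in> M" for z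
    proof (cases "z \<in> B")
      case True
      then show ?thesis using D_0 FB hX by simp
    next
      case False
      then show ?thesis using D_pos that by simp
    qed
    then show "(\<lambda>z. (F z, ?D z)) \<in> topspace mtopology \<rightarrow> ?S \<union> UNIV \<times> {0<..}"
      by auto
  qed
  define V where "V = {z \<in> topspace mtopology. E z \<in> U}"
  have EB: "E b = (k (h b), 0)" if "b \<in> B" for b
    using that FB D_0 by (simp add: E_def)
  show ?thesis
  proof (rule that)
    show "openin Z V"
      unfolding V_def ZM using E U by (rule openin_continuous_map_preimage)
    show "B \<subseteq> V"
      using EB SU BM hX by (auto simp: V_def)
    have "continuous_map (subtopology mtopology V) (subtopology Y U) E"
      using E by (auto simp: V_def continuous_map_in_subtopology continuous_map_from_subtopology)
    from continuous_map_compose[OF continuous_map_compose[OF this r'] fst_S]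
    show "continuous_map (subtopology Z V) X ((k' \<circ> fst) \<circ> (r \<circ> E))"
      unfolding ZM .
    show "((k' \<circ> fst) \<circ> (r \<circ> E)) z = h z" if "z \<in> B" for z
      using EB[OF that] r_id hX[OF that] inv by simp
  qed
qed

section \<open>Open neighbourhoods of closed categorical sets\<close>

text \<open>
  The map on \<open>[0,1] \<times> A \<union> {0} \<times> X \<union> {1} \<times> X\<close> that contracts \<open>A\<close> and is the identity at
  time 0 and constant at time 1 extends to a neighbourhood \<open>V\<close> in \<open>[0,1] \<times> X\<close>. Having the whole
  ends in the domain makes the extension a homotopy between the right maps. Since \<open>[0,1]\<close> is
  compact, the points \<open>x\<close> with \<open>[0,1] \<times> {x} \<subseteq> V\<close> form an open set containing \<open>A\<close>.
\<close>

lemma ANR_closed_categorical_neighbourhood: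
  assumes ANR: "ANR_space X" and A: "closedin X A" and cat: "categorical_in X A"
  obtains U where "openin X U" "A \<subseteq> U" "categorical_in X U"
proof (cases "A = {}")
  case True
  have "categorical_in X {}"
    unfolding categorical_in_def by (intro exI homotopic_with_equal) simp_all
  then show ?thesis using True that[of "{}"] by simp
next
  case False
  obtain c where "homotopic_maps (subtopology X A) X id (\<lambda>_. c)"
    using cat unfolding categorical_in_def by blast
  then obtain H where
    H: "continuous_map (prod_topology (top_of_set {0..1::real}) (subtopology X A)) X H"
    and H0: "\<And>x. H (0, x) = x" and H1: "\<And>x. H (1, x) = c"
    unfolding homotopic_with_def by auto
  have AX: "A \<subseteq> topspace X" using A closedin_subset by blast
  \<comment> \<open>Only a nonempty \<open>A\<close> forces the constant \<open>c\<close> to be a point of \<open>X\<close>.\<close>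
  obtain a where a: "a \<in> A" using False by blast
  have c: "c \<in> topspace X"
  proof -
    have "H (1, a) \<in> topspace X"
      using a AX by (intro continuous_map_image_subset_topspace[OF H, THEN subsetD] imageI) auto
    then show ?thesis using H1 by simp
  qed
  let ?I = "top_of_set {0..1::real}"
  let ?Z = "prod_topology ?I X"
  define T where "T i = (if i = (0::nat) then {0::real} \<times> topspace X
     else if i = 1 then {1} \<times> topspace X else {0..1} \<times> A)" for i
  define p where "p i = (if i = (0::nat) then snd else if i = 1 then (\<lambda>_. c) else H)" for i
  define h where "h z = (if fst z = 0 then snd z else if fst z = 1 then c else H z)" for z
  let ?B = "\<Union>i\<in>{0,1,2}. T i"
  have T: "closedin ?Z (T i)" for i
    using A by (auto simp: T_def closedin_prod_Times_iff closedin_closed_subtopology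
        closedin_topspace[of ?I, simplified])
  have TB: "T i \<subseteq> ?B" if "i \<in> {0,1,2}" for i using that by blast
  have B: "closedin ?Z ?B"
    using T by (intro closedin_Union) auto
  have h: "continuous_map (subtopology ?Z ?B) X h"
  proof (rule pasting_lemma_closed[of "{0,1,2}" _ T _ p])
    show "closedin (subtopology ?Z ?B) (T i)" if "i \<in> {0,1,2}" for i
      by (rule closedin_subset_topspace[OF T TB[OF that]])
    show "continuous_map (subtopology (subtopology ?Z ?B) (T i)) X (p i)"
      if i: "i \<in> {0,1,2}" for i
    proof -
      have eq: "subtopology (subtopology ?Z ?B) (T i) = subtopology ?Z (T i)"
        using TB[OF i] by (simp add: subtopology_subtopology inf_absorb2)
      have "subtopology ?Z ({0..1} \<times> A) = prod_topology ?I (subtopology X A)"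
        by (simp add: subtopology_Times subtopology_subtopology)
      then have "continuous_map (subtopology ?Z (T i)) X (p i)"
        using i c H by (auto simp: p_def T_def continuous_map_from_subtopology continuous_map_snd)
      then show ?thesis unfolding eq .
    qed
    show "p i x = p j x" if "i \<in> {0,1,2}" "j \<in> {0,1,2}"
      "x \<in> topspace (subtopology ?Z ?B) \<inter> T i \<inter> T j" for i j x
      using that H0 H1 by (auto simp: p_def T_def split: if_splits)
    show "\<exists>j. j \<in> {0,1,2} \<and> x \<in> T j \<and> h x = p j x" if "x \<in> topspace (subtopology ?Z ?B)" for x
    proof -
      obtain t y where x: "x = (t, y)" by (cases x)
      have "x \<in> ?B" "y \<in> topspace X" using that x by (auto simp: topspace_subtopology)
      then consider "t = 0" | "t = 1" | "t \<noteq> 0" "t \<noteq> 1" "x \<in> T 2"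
        using x by (auto simp: T_def)
      then show ?thesis
      proof cases
        case 1
        then show ?thesis using x \<open>y \<in> topspace X\<close> by (intro exI[of _ 0]) (simp add: T_def h_def p_def)
      next
        case 2
        then show ?thesis using x \<open>y \<in> topspace X\<close> by (intro exI[of _ 1]) (simp add: T_def h_def p_def)
      next
        case 3
        then show ?thesis using x by (intro exI[of _ 2]) (simp add: h_def p_def)
      qed
    qed
  qed simp
  have Z: "metrizable_space ?Z"
    using ANR_space_imp_metrizable[OF ANR]
    by (simp add: metrizable_space_prod_topology metrizable_space_subtopology metrizable_space_euclidean)
  obtain V g where V: "openin ?Z V" and BV: "?B \<subseteq> V"
    and g: "continuous_map (subtopology ?Z V) X g" and gh: "\<And>z. z \<in> ?B \<Longrightarrow> g z = h z"
    using ANR_neighbourhood_extension[OF ANR Z B h] by blast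
  define U where "U = topspace X - snd ` (topspace ?Z - V)"
  have "compact_space ?I"
    by (simp add: compact_space_subtopology)
  then have "closedin X (snd ` (topspace ?Z - V))"
    using closed_map_snd V unfolding closed_map_def by blast
  then have U: "openin X U"
    unfolding U_def by blast
  have UV: "(t, x) \<in> V" if "0 \<le> t" "t \<le> 1" "x \<in> U" for t x
  proof (rule ccontr)
    assume "(t, x) \<notin> V"
    then have "(t, x) \<in> topspace ?Z - V"
      using that by (simp add: U_def)
    then have "x \<in> snd ` (topspace ?Z - V)" by (metis image_eqI snd_conv)
    then show False using that by (simp add: U_def)
  qed
  have "(t, x) \<in> V" if "(t, x) \<in> topspace ?Z" "x \<in> A" for t x
  proof -
    have "(t, x) \<in> T 2" using that by (simp add: T_def)
    then show ?thesis using BV by blast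
  qed
  then have AU: "A \<subseteq> U"
    using AX unfolding U_def by fastforce
  have UX: "U \<subseteq> topspace X" by (auto simp: U_def)
  have "homotopic_maps (subtopology X U) X id (\<lambda>_. c)"
  proof (subst homotopic_with, simp, intro exI[of _ g] conjI ballI)
    have "{0..1} \<times> U \<subseteq> V" using UV by auto
    then have "subtopology (subtopology ?Z V) ({0..1} \<times> U) = prod_topology ?I (subtopology X U)"
      by (simp add: subtopology_subtopology inf_absorb2 subtopology_Times)
    moreover have "continuous_map (subtopology (subtopology ?Z V) ({0..1} \<times> U)) X g"
      using g by (rule continuous_map_from_subtopology)
    ultimately show "continuous_map (prod_topology ?I (subtopology X U)) X g"
      by simp
    show "g (0, x) = id x" if "x \<in> topspace (subtopology X U)" for x
    proof -
      have "(0, x) \<in> T 0" using that by (simp add: T_def)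
      then have "g (0, x) = h (0, x)" by (intro gh) blast
      then show ?thesis by (simp add: h_def)
    qed
    show "g (1, x) = c" if "x \<in> topspace (subtopology X U)" for x
    proof -
      have "(1, x) \<in> T 1" using that by (simp add: T_def)
      then have "g (1, x) = h (1, x)" by (intro gh) blast
      then show ?thesis by (simp add: h_def)
    qed
  qed simp
  then have "categorical_in X U"
    unfolding categorical_in_def by blast
  then show ?thesis using that U AU by blast
qed


section \<open>Maps into a path-connected space on a categorical cover\<close>

lemma null_homotopic_on_categorical:
  assumes cat: "categorical_in X U" and f: "continuous_map X G f"
    and G: "path_connected_space G" and e: "e \<in> topspace G"
  shows "homotopic_maps (subtopology X U) G f (\<lambda>_. e)"
proof (cases "topspace (subtopology X U) = {}")
  case True
  then show ?thesis
    using continuous_map_from_subtopology[OF f] by (intro homotopic_with_equal) simp_all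
next
  case False
  then obtain x where x: "x \<in> topspace (subtopology X U)" by blast
  obtain c where c: "homotopic_maps (subtopology X U) X id (\<lambda>_. c)"
    using cat unfolding categorical_in_def by blast
  then have fc: "homotopic_maps (subtopology X U) G (f \<circ> id) (f \<circ> (\<lambda>_. c))"
    using f by (rule homotopic_with_compose_continuous_map_left) simp
  then have "continuous_map (subtopology X U) G (f \<circ> (\<lambda>_. c))"
    using homotopic_with_imp_continuous_maps by blast
  from continuous_map_image_subset_topspace[OF this] have "(f \<circ> (\<lambda>_. c)) x \<in> topspace G"
    using x by blast
  then have "f c \<in> topspace G" by simp
  then have "path_component_of G (f c) e"
    using G e by (simp add: path_connected_space_iff_path_component)
  then have "homotopic_maps (subtopology X U) G (\<lambda>_. f c) (\<lambda>_. e)"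
    by (simp add: homotopic_constant_maps)
  moreover have "homotopic_maps (subtopology X U) G f (\<lambda>_. f c)"
    using fc by (simp add: o_def)
  ultimately show ?thesis
    by (rule homotopic_with_trans[rotated])
qed

text \<open>
  Membership in the first term makes the set of indices whose term contains \<open>x\<close> nonempty, so its
  maximum is the depth.
\<close>

lemma series_depth_mem:
  assumes "1 \<le> N" "x \<in> \<Gamma> 1"
  shows "series_depth N \<Gamma> x \<in> {1..N}" "x \<in> \<Gamma> (series_depth N \<Gamma> x)"
proof -
  let ?K = "{k \<in> {1..N}. x \<in> \<Gamma> k}"
  have K: "finite ?K" "?K \<noteq> {}" using assms by force+
  have "\<exists>!k. k \<in> {1..N} \<and> x \<in> \<Gamma> k \<and> (\<forall>j\<in>{1..N}. k < j \<longrightarrow> x \<notin> \<Gamma> j)"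
  proof (rule ex1I[of _ "Max ?K"])
    have "j \<le> Max ?K" if "j \<in> {1..N}" "x \<in> \<Gamma> j" for j
      using Max_ge[OF K(1), of j] that by blast
    then show "Max ?K \<in> {1..N} \<and> x \<in> \<Gamma> (Max ?K) \<and> (\<forall>j\<in>{1..N}. Max ?K < j \<longrightarrow> x \<notin> \<Gamma> j)"
      using Max_in[OF K] by (metis (no_types, lifting) mem_Collect_eq not_less)
    fix k assume k: "k \<in> {1..N} \<and> x \<in> \<Gamma> k \<and> (\<forall>j\<in>{1..N}. k < j \<longrightarrow> x \<notin> \<Gamma> j)"
    have "y \<le> k" if "y \<in> ?K" for y
      using k that by (metis (no_types, lifting) mem_Collect_eq not_less)
    then show "k = Max ?K"
      using k K(1) by (intro Max_eqI[symmetric]) simp_all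
  qed
  from theI'[OF this] show "series_depth N \<Gamma> x \<in> {1..N}" "x \<in> \<Gamma> (series_depth N \<Gamma> x)"
    unfolding series_depth_def by blast+
qed

text \<open>
  The definition of the series provides a null-homotopy of some representative of the class; the
  homotopy from \<open>f\<close> to that representative transfers it to \<open>f\<close>.
\<close>

lemma null_homotopic_of_cover_series:
  assumes f: "continuous_map X G f" and mem: "homotopy_class X G f \<in> cover_series X G \<mu> e A i"
    and S: "S \<subseteq> (\<Union>k<i. A k)"
  shows "homotopic_maps (subtopology X S) G f (\<lambda>_. e)"
proof -
  obtain \<alpha> where "homotopy_class X G f = homotopy_class X G \<alpha>"
    and \<alpha>: "homotopic_maps (subtopology X (\<Union>k<i. A k)) G \<alpha> (\<lambda>_. e)"
    using mem unfolding cover_series_def by blast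
  then have "homotopic_maps X G f \<alpha>"
    using homotopy_class_eq_iff[OF f] by blast
  then have f\<alpha>: "homotopic_maps (subtopology X S) G f \<alpha>"
    by (rule homotopic_from_subtopology)
  have "homotopic_maps (subtopology (subtopology X (\<Union>k<i. A k)) S) G \<alpha> (\<lambda>_. e)"
    using \<alpha> by (rule homotopic_from_subtopology)
  then have "homotopic_maps (subtopology X S) G \<alpha> (\<lambda>_. e)"
    using S by (simp add: subtopology_subtopology inf_absorb2)
  with f\<alpha> show ?thesis by (rule homotopic_with_trans)
qed

lemma homotopic_distance_le:
  assumes "\<And>k. k \<le> r \<Longrightarrow> openin X (U k)" and "(\<Union>k\<le>r. U k) = topspace X"
    and null: "\<And>k i. k \<le> r \<Longrightarrow> i \<in> {1..m} \<Longrightarrow> homotopic_maps (subtopology X (U k)) G (f i) (\<lambda>_. e)"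
  shows "homotopic_distance X G m f \<le> enat r"
proof -
  have "homotopic_maps (subtopology X (U k)) G (f i) (f j)"
    if "k \<le> r" "i \<in> {1..m}" "j \<in> {1..m}" for k i j
    using null[OF that(1,2)] homotopic_with_symD[OF null[OF that(1,3)]]
    by (rule homotopic_with_trans)
  then show ?thesis
    unfolding homotopic_distance_def using assms(1,2) by (intro Inf_lower) blast
qed

text \<open>
  The first member of the open cover is the complement \<open>V\<close> of \<open>A\<^sub>k \<union> \<dots> \<union> A\<^sub>n\<close>, contained in the
  union of the earlier sets, where the maps are null-homotopic by assumption. The other
  \<open>n + 1 - k\<close> members are open categorical neighbourhoods of \<open>A\<^sub>k, \<dots>, A\<^sub>n\<close>.
\<close>

lemma homotopic_distance_le_of_null_on_union:
  assumes ANR: "ANR_space X" and G: "path_connected_space G" and e: "e \<in> topspace G"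
    and A: "closed_categorical_cover X n A"
    and f: "\<And>i. i \<in> {1..m} \<Longrightarrow> continuous_map X G (f i)"
    and null: "\<And>i. i \<in> {1..m} \<Longrightarrow> homotopic_maps (subtopology X (\<Union>j<k. A j)) G (f i) (\<lambda>_. e)"
  shows "homotopic_distance X G m f \<le> enat (n + 1 - k)"
proof -
  have Acl: "closedin X (A j)" and Acat: "categorical_in X (A j)" if "j \<le> n" for j
    using A that by (auto simp: closed_categorical_cover_def)
  have Acov: "(\<Union>j\<le>n. A j) = topspace X"
    using A by (simp add: closed_categorical_cover_def)
  have "\<exists>U. openin X U \<and> A j \<subseteq> U \<and> categorical_in X U" if "j \<le> n" for j
    using ANR_closed_categorical_neighbourhood[OF ANR Acl[OF that] Acat[OF that]] by blast
  then obtain U where U: "openin X (U j)" "A j \<subseteq> U j" "categorical_in X (U j)" if "j \<le> n" for j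
    by metis
  define V where "V = topspace X - (\<Union>j\<in>{k..n}. A j)"
  have V: "openin X V"
    unfolding V_def using Acl by (intro openin_diff openin_topspace closedin_Union) auto
  have "x \<in> (\<Union>j<k. A j)" if x: "x \<in> V" for x
  proof -
    obtain j where j: "j \<le> n" "x \<in> A j" using x Acov by (auto simp: V_def)
    moreover have "\<not> k \<le> j" using j x by (auto simp: V_def)
    ultimately show ?thesis by auto
  qed
  then have V_sub: "V \<subseteq> (\<Union>j<k. A j)" by blast
  define W where "W l = (if l = 0 then V else U (k + l - 1))" for l
  have W: "openin X (W l)" if "l \<le> n + 1 - k" for l
    using V U(1)[of "k + l - 1"] that by (simp add: W_def)
  show ?thesis
  proof (rule homotopic_distance_le[where U = W and e = e])
    fix l i assume l: "l \<le> n + 1 - k" and i: "i \<in> {1..m}"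
    show "homotopic_maps (subtopology X (W l)) G (f i) (\<lambda>_. e)"
    proof (cases "l = 0")
      case True
      have "homotopic_maps (subtopology (subtopology X (\<Union>j<k. A j)) V) G (f i) (\<lambda>_. e)"
        using null[OF i] by (rule homotopic_from_subtopology)
      then show ?thesis
        using V_sub True by (simp add: W_def subtopology_subtopology inf_absorb2)
    next
      case False
      then have "categorical_in X (U (k + l - 1))" using l by (intro U(3)) simp
      then show ?thesis
        using null_homotopic_on_categorical[OF _ f[OF i] G e] False by (simp add: W_def)
    qed
  next
    show "(\<Union>l\<le>n + 1 - k. W l) = topspace X"
    proof
      show "(\<Union>l\<le>n + 1 - k. W l) \<subseteq> topspace X"
        using W openin_subset by blast
      show "topspace X \<subseteq> (\<Union>l\<le>n + 1 - k. W l)"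
      proof
        fix x assume x: "x \<in> topspace X"
        show "x \<in> (\<Union>l\<le>n + 1 - k. W l)"
        proof (cases "x \<in> V")
          case True
          then have "x \<in> W 0" by (simp add: W_def)
          then show ?thesis by blast
        next
          case False
          then obtain j where j: "k \<le> j" "j \<le> n" "x \<in> A j" using x by (auto simp: V_def)
          then have "x \<in> W (j + 1 - k)" using U(2)[OF j(2)] by (auto simp: W_def)
          moreover have "j + 1 - k \<le> n + 1 - k" using j by simp
          ultimately show ?thesis by blast
        qed
      qed
    qed
  qed (rule W)
qed

theorem theorem1p3:
  fixes X :: "'a topology" and G :: "'b topology"
    and \<mu> :: "'b \<times> 'b \<Rightarrow> 'b" and e :: 'b and \<eta> :: "'b \<Rightarrow> 'b"
    and m n :: nat and f :: "nat \<Rightarrow> 'a \<Rightarrow> 'b" and A :: "nat \<Rightarrow> 'a set"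
  assumes "ANR_space X"
    and "group_like_space G \<mu> e \<eta>"
    and "m \<ge> 2"
    and "\<And>i. i \<in> {1..m} \<Longrightarrow> continuous_map X G (f i)"
    and "LS_cat X = enat n"
    and "closed_categorical_cover X n A"
  shows "ereal_of_enat (homotopic_distance X G m f)
    \<le> ereal_of_enat (LS_cat X)
      - ereal (real (Min {series_depth (n + 1) (cover_series X G \<mu> e A) (homotopy_class X G (f i)) | i.
                            i \<in> {1..m}}))
      + 1"
proof -
  have G: "path_connected_space G" and e: "e \<in> topspace G"
    using assms(2) by (auto simp: group_like_space_def H_space_def)
  let ?\<Gamma> = "cover_series X G \<mu> e A"
  define dep where "dep i = series_depth (n + 1) ?\<Gamma> (homotopy_class X G (f i))" for i
  define k where "k = Min {dep i | i. i \<in> {1..m}}"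
  have dep: "dep i \<in> {1..n + 1}" "homotopy_class X G (f i) \<in> ?\<Gamma> (dep i)" if i: "i \<in> {1..m}" for i
  proof -
    \<comment> \<open>The set \<open>A\<^sub>0\<close> is categorical, so the first term of the series is the whole group.\<close>
    have "categorical_in X (A 0)"
      using assms(6) by (simp add: closed_categorical_cover_def)
    then have "homotopic_maps (subtopology X (\<Union>j<1::nat. A j)) G (f i) (\<lambda>_. e)"
      using null_homotopic_on_categorical[OF _ assms(4)[OF i] G e] by (simp add: lessThan_Suc)
    then have mem1: "homotopy_class X G (f i) \<in> ?\<Gamma> 1"
      unfolding cover_series_def homotopy_group_def using assms(4)[OF i] by auto
    have "1 \<le> n + 1" by simp
    note series_depth_mem[of "n + 1" "homotopy_class X G (f i)" ?\<Gamma>, OF this mem1]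
    then show "dep i \<in> {1..n + 1}" "homotopy_class X G (f i) \<in> ?\<Gamma> (dep i)"
      unfolding dep_def .
  qed
  have fin: "finite {dep i | i. i \<in> {1..m}}" by simp
  have k_le: "k \<le> dep i" if "i \<in> {1..m}" for i
    unfolding k_def using that by (intro Min_le fin) blast
  have "1 \<in> {1..m}" using assms(3) by simp
  then have k_le_n: "k \<le> n + 1"
    using k_le dep(1) by (meson atLeastAtMost_iff order_trans)
  have "homotopic_distance X G m f \<le> enat (n + 1 - k)"
  proof (rule homotopic_distance_le_of_null_on_union[OF assms(1) G e assms(6,4)])
    fix i assume i: "i \<in> {1..m}"
    have "(\<Union>j<k. A j) \<subseteq> (\<Union>j<dep i. A j)"
      using k_le[OF i] by (intro SUP_subset_mono) auto
    then show "homotopic_maps (subtopology X (\<Union>j<k. A j)) G (f i) (\<lambda>_. e)"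
      by (rule null_homotopic_of_cover_series[OF assms(4)[OF i] dep(2)[OF i]])
  qed
  then have "ereal_of_enat (homotopic_distance X G m f) \<le> ereal_of_enat (enat (n + 1 - k))"
    by (simp only: ereal_of_enat_le_iff)
  also have "\<dots> = ereal_of_enat (LS_cat X) - ereal (real k) + 1"
    using k_le_n assms(5) by (simp add: of_nat_diff one_ereal_def)
  finally show ?thesis unfolding k_def dep_def .
qed

end
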